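(* Let $A$ be a $k\times k$ complex matrix, and let $\chi_A(x)=(x-\alpha_1)^{m_1}(x-\alpha_2)^{m_2}\cdots(x-\alpha_s)^{m_s}$ be its characteristic polynomial, where $\alpha_1,\ldots,\alpha_s$ are distinct complex numbers, $\alpha_1=0$, $m_1\ge 0$ (possibly $m_1=0$), and $m_j\ge 1$ for $j\ge 2$. For $1\le j\le s$ and $0\le r\le m_j-1$ put $B_{jr}=L_{jr}(A)[\chi_A]$. Then for every $n\in\mathbb{N}=\{0,1,2,\ldots\}$, $$A^{n}=\sum_{j=0}^{m_1-1}\delta_{nj}B_{1j}+\sum_{j=0}^{m_2-1}\binom{n}{j}\alpha_2^{n-j}B_{2j}+\cdots+\sum_{j=0}^{m_s-1}\binom{n}{j}\alpha_s^{n-j}B_{sj},$$ where $\delta_{nj}$ is the Kronecker symbol.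
   Context: For a non-constant polynomial $P(x)=(x-\alpha_1)^{m_1}\cdots(x-\alpha_s)^{m_s}$ with $\alpha_1,\ldots,\alpha_s\in\mathbb{C}$ distinct and $m_1,\ldots,m_s$ nonnegative integers, set, for $1\le j\le s$, $P_j(x)=\prod_{i\ne j}(x-\alpha_i)^{m_i}=P(x)/(x-\alpha_j)^{m_j}$ and $g_j(x)=1/P_j(x)$. For $1\le j\le s$ and $0\le r\le m_j-1$ define the polynomial $$L_{jr}(x)[P]=P_j(x)(x-\alpha_j)^{r}\sum_{i=0}^{m_j-1-r}\frac{1}{i!}g_j^{(i)}(\alpha_j)(x-\alpha_j)^i.$$ $L_{jr}(A)[P]$ denotes the evaluation of this polynomial at the matrix $A$. Empty sums are zero, $\binom{n}{j}=0$ for $j>n$, and $A^0=I$. *)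

theory Defs
  imports "HOL-Analysis.Derivative" "Jordan_Normal_Form.Char_Poly"
begin

text \<open>
  A polynomial \<open>P = (\<Prod>i=1..s. (x - \<alpha> i) ^ m i)\<close> is given by the data \<open>\<alpha>\<close>, \<open>m\<close>, \<open>s\<close>;
  values of \<open>\<alpha>\<close> and \<open>m\<close> outside \<open>{1..s}\<close> are irrelevant.
\<close>

definition factored_poly :: "(nat \<Rightarrow> complex) \<Rightarrow> (nat \<Rightarrow> nat) \<Rightarrow> nat \<Rightarrow> complex poly" where
  "factored_poly \<alpha> m s = (\<Prod>i\<in>{1..s}. [:- \<alpha> i, 1:] ^ m i)"

definition cofactor_poly :: "(nat \<Rightarrow> complex) \<Rightarrow> (nat \<Rightarrow> nat) \<Rightarrow> nat \<Rightarrow> nat \<Rightarrow> complex poly" where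
  "cofactor_poly \<alpha> m s j = (\<Prod>i\<in>{1..s} - {j}. [:- \<alpha> i, 1:] ^ m i)"

definition recip_cofactor :: "(nat \<Rightarrow> complex) \<Rightarrow> (nat \<Rightarrow> nat) \<Rightarrow> nat \<Rightarrow> nat \<Rightarrow> complex \<Rightarrow> complex" where
  "recip_cofactor \<alpha> m s j x = 1 / poly (cofactor_poly \<alpha> m s j) x"

text \<open>
  The summation range \<open>0 \<le> i \<le> m j - 1 - r\<close> is written \<open>i < m j - r\<close>, so that truncated
  subtraction gives the empty sum when \<open>r \<ge> m j\<close>.
\<close>

definition L_poly :: "(nat \<Rightarrow> complex) \<Rightarrow> (nat \<Rightarrow> nat) \<Rightarrow> nat \<Rightarrow> nat \<Rightarrow> nat \<Rightarrow> complex poly" where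
  "L_poly \<alpha> m s j r =
     cofactor_poly \<alpha> m s j * [:- \<alpha> j, 1:] ^ r *
     (\<Sum>i<m j - r. Polynomial.smult (1 / fact i * (deriv ^^ i) (recip_cofactor \<alpha> m s j) (\<alpha> j))
                     ([:- \<alpha> j, 1:] ^ i))"

text \<open>
  Matrices of type \<open>_ mat\<close> carry their dimensions as values, so the type has no zero matrix and
  finite sums of \<open>k \<times> k\<close> matrices are taken in the module \<open>module_mat _ k k\<close>.
\<close>

definition poly_mat :: "'a :: comm_ring_1 poly \<Rightarrow> 'a mat \<Rightarrow> 'a mat" where
  "poly_mat p A =
     (\<Oplus>\<^bsub>module_mat TYPE('a) (dim_row A) (dim_row A)\<^esub>i\<in>{..degree p}. coeff p i \<cdot>\<^sub>m (A ^\<^sub>m i))"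

end

theory Submission
  imports Defs "HOL-Analysis.FPS_Convergence" "HOL-Computational_Algebra.Field_as_Ring"
    "HOL-Computational_Algebra.Polynomial_Factorial"
begin

text \<open>
  Put \<open>\<chi> = (\<Prod>i. (x - \<alpha> i) ^ m i)\<close>. The polynomials \<open>L_poly \<alpha> m s j r\<close> solve the Hermite interpolation
  problem at the roots of \<open>\<chi>\<close>: modulo \<open>(x - \<alpha> j) ^ m j\<close> the polynomial with indices \<open>j\<close>, \<open>r\<close> is
  \<open>(x - \<alpha> j) ^ r\<close>, because its last factor is a truncated Taylor expansion of the reciprocal of its
  first factor (\<open>linear_power_dvd_L_poly_own\<close>); modulo \<open>(x - \<alpha> l) ^ m l\<close> with \<open>l \<noteq> j\<close> it vanishes, because
  the cofactor contains that power (\<open>linear_power_dvd_L_poly_other\<close>).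

  By the binomial theorem \<open>x ^ n\<close> is the sum of \<open>(n choose r) * \<alpha> j ^ (n - r) * (x - \<alpha> j) ^ r\<close> over
  \<open>r < m j\<close>, modulo \<open>(x - \<alpha> j) ^ m j\<close>. Hence \<open>x ^ n\<close> and the combination of the \<open>L_poly \<alpha> m s j r\<close> with
  these coefficients agree modulo every \<open>(x - \<alpha> j) ^ m j\<close>, and since these powers are pairwise
  coprime the difference is a multiple of \<open>\<chi>\<close> (\<open>factored_poly_dvd_monom_diff_interpolation\<close>).
  The Cayley-Hamilton theorem makes that multiple vanish at \<open>A\<close>
  (\<open>char_poly_dvd_imp_poly_mat_eq_0\<close>), and this is the power formula: at the root \<open>0\<close> the coefficient
  \<open>(n choose r) * 0 ^ (n - r)\<close> is the Kronecker delta.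
\<close>

section \<open>Entries of matrix polynomials\<close>

text \<open>
  Evaluation at a matrix is handled entry by entry: for fixed indices \<open>a\<close>, \<open>b\<close> the map
  \<open>p \<mapsto> poly_mat p A $$ (a, b)\<close> is a linear functional on polynomials. This turns every sum in the
  matrix module into an ordinary sum of scalars.
\<close>

lemma abelian_monoid_module_mat:
  "abelian_monoid (module_mat TYPE('a :: comm_ring_1) r c)"
  by (rule abelian_group.axioms(1)[OF abelian_group_mat])

lemma finsum_module_mat_carrier:
  fixes f :: "'i \<Rightarrow> 'a :: comm_ring_1 mat"
  assumes "\<And>i. i \<in> S \<Longrightarrow> f i \<in> carrier_mat r c"
  shows "(\<Oplus>\<^bsub>module_mat TYPE('a) r c\<^esub>i\<in>S. f i) \<in> carrier_mat r c"
  using abelian_monoid.finsum_closed[OF abelian_monoid_module_mat, of f S r c] assms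
  by (auto simp: module_mat_simps)

lemma index_finsum_module_mat:
  fixes f :: "'i \<Rightarrow> 'a :: comm_ring_1 mat"
  assumes "finite S" and "\<And>i. i \<in> S \<Longrightarrow> f i \<in> carrier_mat r c" and "a < r" and "b < c"
  shows "(\<Oplus>\<^bsub>module_mat TYPE('a) r c\<^esub>i\<in>S. f i) $$ (a, b) = (\<Sum>i\<in>S. f i $$ (a, b))"
  using assms(1,2)
proof (induction S rule: finite_induct)
  case empty
  show ?case
    using abelian_monoid.finsum_empty[OF abelian_monoid_module_mat, of r c f] assms(3,4)
    by (simp add: module_mat_simps)
next
  case (insert i S)
  have "(\<Oplus>\<^bsub>module_mat TYPE('a) r c\<^esub>i\<in>insert i S. f i) =
      f i + (\<Oplus>\<^bsub>module_mat TYPE('a) r c\<^esub>i\<in>S. f i)"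
    using abelian_monoid.finsum_insert[OF abelian_monoid_module_mat, of S i f r c] insert
    by (auto simp: module_mat_simps)
  moreover have "(\<Oplus>\<^bsub>module_mat TYPE('a) r c\<^esub>i\<in>S. f i) \<in> carrier_mat r c"
    using insert.prems by (intro finsum_module_mat_carrier) auto
  ultimately show ?case
    using insert assms(3,4) by simp
qed

lemma index_finsum_module_mat_smult:
  fixes f :: "'i \<Rightarrow> 'a :: comm_ring_1 mat"
  assumes "finite S" and "\<And>i. i \<in> S \<Longrightarrow> f i \<in> carrier_mat r c" and "a < r" and "b < c"
  shows "(\<Oplus>\<^bsub>module_mat TYPE('a) r c\<^esub>i\<in>S. u i \<cdot>\<^sub>m f i) $$ (a, b) = (\<Sum>i\<in>S. u i * f i $$ (a, b))"
proof -
  have "(u i \<cdot>\<^sub>m f i) $$ (a, b) = u i * f i $$ (a, b)" if "i \<in> S" for i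
    using assms(2)[OF that] assms(3,4) by simp
  then show ?thesis
    using assms by (subst index_finsum_module_mat) auto
qed

context
  fixes A :: "'a :: comm_ring_1 mat" and k :: nat
  assumes A: "A \<in> carrier_mat k k"
begin

lemma poly_mat_carrier: "poly_mat p A \<in> carrier_mat k k"
  using A unfolding poly_mat_def by (auto intro!: finsum_module_mat_carrier)

text \<open>
  Any bound above the degree may be used, so that two polynomials of different degrees can be
  evaluated over a common range.
\<close>

lemma poly_mat_index:
  assumes "a < k" and "b < k" and "degree p \<le> N"
  shows "poly_mat p A $$ (a, b) = (\<Sum>i\<le>N. coeff p i * (A ^\<^sub>m i) $$ (a, b))"
proof -
  have "poly_mat p A $$ (a, b) = (\<Sum>i\<le>degree p. coeff p i * (A ^\<^sub>m i) $$ (a, b))"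
    unfolding poly_mat_def using A assms by (intro index_finsum_module_mat_smult) auto
  also have "\<dots> = (\<Sum>i\<le>N. coeff p i * (A ^\<^sub>m i) $$ (a, b))"
    using assms(3) by (intro sum.mono_neutral_left) (auto simp: coeff_eq_0)
  finally show ?thesis .
qed

lemma poly_mat_index_0:
  assumes "a < k" and "b < k"
  shows "poly_mat 0 A $$ (a, b) = 0"
  using poly_mat_index[OF assms, of 0 0] by simp

lemma poly_mat_index_add:
  assumes "a < k" and "b < k"
  shows "poly_mat (p + q) A $$ (a, b) = poly_mat p A $$ (a, b) + poly_mat q A $$ (a, b)"
  using poly_mat_index[OF assms, of "p + q" "max (degree p) (degree q)"]
    poly_mat_index[OF assms, of p "max (degree p) (degree q)"]
    poly_mat_index[OF assms, of q "max (degree p) (degree q)"]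
  by (simp add: degree_add_le_max algebra_simps sum.distrib)

lemma poly_mat_index_smult:
  assumes "a < k" and "b < k"
  shows "poly_mat (Polynomial.smult c p) A $$ (a, b) = c * poly_mat p A $$ (a, b)"
  using poly_mat_index[OF assms, of "Polynomial.smult c p" "degree p"]
    poly_mat_index[OF assms, of p "degree p"]
  by (simp add: degree_smult_le sum_distrib_left mult.assoc)

lemma poly_mat_index_diff:
  assumes "a < k" and "b < k"
  shows "poly_mat (p - q) A $$ (a, b) = poly_mat p A $$ (a, b) - poly_mat q A $$ (a, b)"
  using poly_mat_index_add[OF assms, of "p - q" q] by simp

lemma poly_mat_index_sum:
  assumes "a < k" and "b < k"
  shows "poly_mat (\<Sum>i\<in>S. f i) A $$ (a, b) = (\<Sum>i\<in>S. poly_mat (f i) A $$ (a, b))"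
  by (induction S rule: infinite_finite_induct)
    (simp_all add: poly_mat_index_0 poly_mat_index_add assms)

lemma poly_mat_index_monom:
  assumes "a < k" and "b < k"
  shows "poly_mat (monom 1 n) A $$ (a, b) = (A ^\<^sub>m n) $$ (a, b)"
  using poly_mat_index[OF assms, of "monom 1 n" n]
  by (simp add: degree_monom_le if_distrib[of "\<lambda>x. x * _"] cong: if_cong)

text \<open>
  This is \<open>(x * p)(A) = p(A) * A\<close>, the multiplicative property of evaluation behind the
  Cayley-Hamilton theorem.
\<close>

lemma poly_mat_index_pCons_0:
  assumes "a < k" and "b < k"
  shows "poly_mat (pCons 0 p) A $$ (a, b) = (\<Sum>c<k. poly_mat p A $$ (a, c) * A $$ (c, b))"
proof -
  have power_Suc_index: "(A ^\<^sub>m Suc i) $$ (a, b) = (\<Sum>c<k. (A ^\<^sub>m i) $$ (a, c) * A $$ (c, b))" for i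
    using A assms pow_carrier_mat[OF A, of i]
    by (auto simp: scalar_prod_def lessThan_atLeast0 intro!: sum.cong)
  have "poly_mat (pCons 0 p) A $$ (a, b) =
      (\<Sum>i\<le>Suc (degree p). coeff (pCons 0 p) i * (A ^\<^sub>m i) $$ (a, b))"
    using assms by (intro poly_mat_index) (auto simp: degree_pCons_le)
  also have "\<dots> = (\<Sum>i\<le>degree p. coeff p i * (A ^\<^sub>m Suc i) $$ (a, b))"
    by (subst sum.atMost_Suc_shift) simp
  also have "\<dots> = (\<Sum>i\<le>degree p. \<Sum>c<k. coeff p i * (A ^\<^sub>m i) $$ (a, c) * A $$ (c, b))"
    unfolding power_Suc_index by (simp add: sum_distrib_left mult.assoc)
  also have "\<dots> = (\<Sum>c<k. (\<Sum>i\<le>degree p. coeff p i * (A ^\<^sub>m i) $$ (a, c)) * A $$ (c, b))"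
    by (subst sum.swap) (simp add: sum_distrib_right)
  also have "\<dots> = (\<Sum>c<k. poly_mat p A $$ (a, c) * A $$ (c, b))"
    using assms by (intro sum.cong) (auto simp: poly_mat_index[where N = "degree p"])
  finally show ?thesis .
qed

section \<open>The Cayley-Hamilton theorem\<close>

text \<open>
  Write \<open>N\<close> as \<open>\<Sum>i. x ^ i * N i\<close> with constant matrices \<open>N i\<close>, and evaluate polynomial matrices by
  putting the powers of \<open>A\<close> on the left: \<open>N\<close> goes to \<open>\<Sum>i. A ^ i * N i\<close>. The sum over \<open>c\<close> below is an entry of
  the value of \<open>(x - A) * N\<close>. That value is zero, since multiplication by \<open>x\<close> contributes
  \<open>\<Sum>i. A ^ (i + 1) * N i\<close> and multiplication by \<open>A\<close> from the left contributes \<open>\<Sum>i. A ^ i * (A * N i)\<close>.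
\<close>

lemma char_poly_matrix_mult_vanishes:
  assumes N: "N \<in> carrier_mat k k" and a: "a < k" and b: "b < k"
  shows "(\<Sum>c<k. poly_mat ((char_poly_matrix A * N) $$ (c, b)) A $$ (a, c)) = 0"
proof -
  have entry: "(char_poly_matrix A * N) $$ (c, b) =
      pCons 0 (N $$ (c, b)) - (\<Sum>d<k. Polynomial.smult (A $$ (c, d)) (N $$ (d, b)))"
    if c: "c < k" for c
  proof -
    have "(char_poly_matrix A * N) $$ (c, b) =
        (\<Sum>d<k. (if c = d then pCons 0 (N $$ (d, b)) else 0)
                - Polynomial.smult (A $$ (c, d)) (N $$ (d, b)))"
      using A N b c unfolding char_poly_matrix_def
      by (auto simp: scalar_prod_def lessThan_atLeast0 algebra_simps intro!: sum.cong)
    then show ?thesis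
      using c by (simp add: sum_subtractf)
  qed
  have "(\<Sum>c<k. poly_mat ((char_poly_matrix A * N) $$ (c, b)) A $$ (a, c)) =
      (\<Sum>c<k. poly_mat (pCons 0 (N $$ (c, b))) A $$ (a, c))
      - (\<Sum>c<k. \<Sum>d<k. A $$ (c, d) * poly_mat (N $$ (d, b)) A $$ (a, c))"
    using a by (simp add: entry poly_mat_index_diff poly_mat_index_sum poly_mat_index_smult
        sum_subtractf)
  also have "(\<Sum>c<k. \<Sum>d<k. A $$ (c, d) * poly_mat (N $$ (d, b)) A $$ (a, c)) =
      (\<Sum>d<k. poly_mat (pCons 0 (N $$ (d, b))) A $$ (a, d))"
    using a by (subst sum.swap) (simp add: poly_mat_index_pCons_0 mult.commute)
  finally show ?thesis
    by simp
qed

text \<open>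
  If \<open>p = det (x - A) * q\<close> then \<open>p\<close> times the identity factors as \<open>(x - A) * (q * adj (x - A))\<close>, and matrices with the
  left factor \<open>x - A\<close> evaluate to zero at \<open>A\<close>.
\<close>

lemma char_poly_dvd_imp_poly_mat_eq_0:
  assumes "char_poly A dvd p" and a: "a < k" and b: "b < k"
  shows "poly_mat p A $$ (a, b) = 0"
proof -
  obtain q where p: "p = char_poly A * q"
    using assms(1) by (elim dvdE)
  define adj where "adj = adj_mat (char_poly_matrix A)"
  have C: "char_poly_matrix A \<in> carrier_mat k k"
    using A by simp
  have adj: "adj \<in> carrier_mat k k"
    and C_adj: "char_poly_matrix A * adj = char_poly A \<cdot>\<^sub>m 1\<^sub>m k"
    using adj_mat[OF C] by (simp_all add: adj_def char_poly_def)
  have "char_poly_matrix A * (q \<cdot>\<^sub>m adj) = q \<cdot>\<^sub>m (char_poly A \<cdot>\<^sub>m 1\<^sub>m k)"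
    unfolding C_adj[symmetric] using C adj by (rule mult_smult_distrib)
  then have entry: "(char_poly_matrix A * (q \<cdot>\<^sub>m adj)) $$ (c, b) = (if c = b then p else 0)"
    if "c < k" for c
    using that b by (simp add: p mult.commute)
  have "0 = (\<Sum>c<k. poly_mat ((char_poly_matrix A * (q \<cdot>\<^sub>m adj)) $$ (c, b)) A $$ (a, c))"
    using char_poly_matrix_mult_vanishes[of "q \<cdot>\<^sub>m adj"] adj a b by simp
  also have "\<dots> = (\<Sum>c<k. if c = b then poly_mat p A $$ (a, c) else 0)"
    using a by (intro sum.cong) (auto simp: entry poly_mat_index_0)
  also have "\<dots> = poly_mat p A $$ (a, b)"
    using b by simp
  finally show ?thesis
    by simp
qed

end

section \<open>Truncated Taylor expansion of a reciprocal\<close>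

lemma has_fps_expansion_poly:
  fixes p :: "'a :: {banach, real_normed_div_algebra, field} poly"
  shows "poly p has_fps_expansion fps_of_poly p"
proof (induction p)
  case 0
  then show ?case
    using has_fps_expansion_0 by (simp add: poly_0[abs_def])
next
  case (pCons c p)
  have "(\<lambda>x. c + x * poly p x) has_fps_expansion fps_const c + fps_X * fps_of_poly p"
    by (intro has_fps_expansion_add has_fps_expansion_mult has_fps_expansion_const
        has_fps_expansion_fps_X pCons.IH)
  then show ?case
    by (simp add: fps_of_poly_pCons poly_pCons[abs_def] algebra_simps)
qed

text \<open>
  The Taylor coefficients of \<open>1 / p\<close> at \<open>a\<close> are those of a formal inverse; this replaces repeated
  differentiation by the convolution identity for a product of power series.
\<close>

lemma higher_deriv_inverse_poly:
  fixes p :: "complex poly"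
  assumes "poly p a \<noteq> 0"
  shows "(deriv ^^ i) (\<lambda>x. 1 / poly p x) a / fact i =
    fps_nth (inverse (fps_of_poly (pcompose p [:a, 1:]))) i"
proof -
  let ?F = "fps_of_poly (pcompose p [:a, 1:])"
  have "(\<lambda>x. inverse (poly (pcompose p [:a, 1:]) x)) has_fps_expansion inverse ?F"
    using assms by (intro has_fps_expansion_inverse has_fps_expansion_poly) simp
  then have "fps_nth (inverse ?F) i =
      (deriv ^^ i) (\<lambda>x. inverse (poly (pcompose p [:a, 1:]) x)) 0 / fact i"
    by (rule fps_nth_fps_expansion)
  also have "(\<lambda>x. inverse (poly (pcompose p [:a, 1:]) x)) = (\<lambda>x. 1 / poly p x) \<circ> (\<lambda>x. a + x)"
    by (auto simp: poly_pcompose inverse_eq_divide add.commute)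
  finally show ?thesis
    by (simp add: higher_deriv_shift_0[of i _ a] comp_def)
qed

text \<open>
  After the shift by \<open>a\<close>, the claim is that the product of \<open>p\<close> with its inverse power series, cut off
  at degree \<open>N\<close>, has the same coefficients below \<open>N\<close> as \<open>1\<close>. Each such coefficient of a product
  only involves coefficients below \<open>N\<close> of the factors, so the cut-off does not change it.
\<close>

lemma linear_power_dvd_mult_truncated_reciprocal:
  fixes p :: "complex poly"
  assumes "poly p a \<noteq> 0"
  shows "[:- a, 1:] ^ N dvd
    p * (\<Sum>i<N. Polynomial.smult (1 / fact i * (deriv ^^ i) (\<lambda>x. 1 / poly p x) a)
                  ([:- a, 1:] ^ i)) - 1"
proof -
  define q where "q = pcompose p [:a, 1:]"
  define G where "G = inverse (fps_of_poly q)"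
  define T where "T = (\<Sum>i<N. monom (fps_nth G i) i)"
  have q0: "fps_nth (fps_of_poly q) 0 \<noteq> 0"
    using assms by (simp add: q_def)
  have coeff_T: "coeff T i = fps_nth G i" if "i < N" for i
    using that by (simp add: T_def coeff_sum)
  have "coeff (q * T - 1) j = 0" if "j < N" for j
  proof -
    have "coeff (q * T) j = (\<Sum>i\<le>j. coeff q i * coeff T (j - i))"
      by (rule coeff_mult)
    also have "\<dots> = (\<Sum>i\<le>j. fps_nth (fps_of_poly q) i * fps_nth G (j - i))"
      using that by (intro sum.cong) (auto simp: coeff_T)
    also have "\<dots> = fps_nth (fps_of_poly q * G) j"
      by (simp add: fps_mult_nth atLeast0AtMost)
    also have "fps_of_poly q * G = 1"
      using inverse_mult_eq_1'[OF q0] by (simp add: G_def)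
    finally show ?thesis
      by (simp add: coeff_1)
  qed
  then have "monom 1 N dvd q * T - 1"
    by (subst monom_1_dvd_iff') blast
  then obtain r where r: "q * T - 1 = monom 1 N * r"
    by (elim dvdE)
  have "pcompose (q * T - 1) [:- a, 1:] = [:- a, 1:] ^ N * pcompose r [:- a, 1:]"
    unfolding r by (simp add: pcompose_mult monom_altdef pcompose_hom.hom_power pcompose_pCons)
  moreover have "pcompose q [:- a, 1:] = p"
    unfolding q_def by (simp add: pcompose_assoc[symmetric] pcompose_pCons)
  moreover have "pcompose T [:- a, 1:] = (\<Sum>i<N. Polynomial.smult
      (1 / fact i * (deriv ^^ i) (\<lambda>x. 1 / poly p x) a) ([:- a, 1:] ^ i))"
    unfolding T_def G_def q_def higher_deriv_inverse_poly[OF assms, symmetric]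
    by (simp add: pcompose_sum monom_altdef pcompose_smult pcompose_hom.hom_power pcompose_pCons)
  ultimately show ?thesis
    by (simp add: pcompose_diff pcompose_mult pcompose_1)
qed

section \<open>Hermite interpolation of the monomials\<close>

lemma coprime_linear_powers:
  fixes a b :: "'a :: field_gcd"
  assumes "a \<noteq> b"
  shows "coprime ([:- a, 1:] ^ i) ([:- b, 1:] ^ j)"
proof -
  have "coprime [:- a, 1:] [:- b, 1:]"
  proof (rule coprimeI)
    fix c assume "c dvd [:- a, 1:]" "c dvd [:- b, 1:]"
    then have "c dvd [:- a, 1:] - [:- b, 1:]"
      by (rule dvd_diff)
    also have "[:- a, 1:] - [:- b, 1:] = [:b - a:]"
      by simp
    also have "\<dots> dvd 1"
      using assms by (simp add: is_unit_const_poly_iff dvd_field_iff)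
    finally show "is_unit c" .
  qed
  then show ?thesis
    by simp
qed

lemma factored_poly_dvdI:
  assumes "inj_on \<alpha> {1..s}"
    and "\<And>l. l \<in> {1..s} \<Longrightarrow> [:- \<alpha> l, 1:] ^ m l dvd p"
  shows "factored_poly \<alpha> m s dvd p"
proof -
  have "(\<Prod>i\<in>S. [:- \<alpha> i, 1:] ^ m i) dvd p" if "finite S" "S \<subseteq> {1..s}" for S
    using that
  proof (induction S rule: finite_induct)
    case (insert i S)
    have "coprime ([:- \<alpha> i, 1:] ^ m i) (\<Prod>j\<in>S. [:- \<alpha> j, 1:] ^ m j)"
      using insert assms(1) by (intro prod_coprime_right coprime_linear_powers)
        (auto dest!: inj_onD)
    then show ?case
      using insert assms(2) by (auto intro!: divides_mult)
  qed simp
  then show ?thesis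
    unfolding factored_poly_def by blast
qed

lemma linear_power_dvd_L_poly_other:
  assumes "l \<in> {1..s}" and "l \<noteq> j"
  shows "[:- \<alpha> l, 1:] ^ m l dvd L_poly \<alpha> m s j r"
proof -
  have "[:- \<alpha> l, 1:] ^ m l dvd cofactor_poly \<alpha> m s j"
    unfolding cofactor_poly_def using assms by (intro dvd_prodI) auto
  then show ?thesis
    unfolding L_poly_def by (simp add: dvd_mult2)
qed

lemma poly_cofactor_poly_nonzero:
  assumes "inj_on \<alpha> {1..s}" and "j \<in> {1..s}"
  shows "poly (cofactor_poly \<alpha> m s j) (\<alpha> j) \<noteq> 0"
  using assms by (auto simp: cofactor_poly_def poly_prod dest: inj_onD)

text \<open>
  The Taylor sum is cut off at \<open>m j - r\<close>, so its product with the cofactor is \<open>1\<close> modulo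
  \<open>(x - \<alpha> j) ^ (m j - r)\<close>; the factor \<open>(x - \<alpha> j) ^ r\<close> supplies the missing powers.
\<close>

lemma linear_power_dvd_L_poly_own:
  assumes "inj_on \<alpha> {1..s}" and "j \<in> {1..s}" and "r < m j"
  shows "[:- \<alpha> j, 1:] ^ m j dvd L_poly \<alpha> m s j r - [:- \<alpha> j, 1:] ^ r"
proof -
  let ?x = "[:- \<alpha> j, 1:]" and ?c = "cofactor_poly \<alpha> m s j"
  let ?T = "\<Sum>i<m j - r. Polynomial.smult
    (1 / fact i * (deriv ^^ i) (recip_cofactor \<alpha> m s j) (\<alpha> j)) (?x ^ i)"
  have "?x ^ (m j - r) dvd ?c * ?T - 1"
    using linear_power_dvd_mult_truncated_reciprocal[OF poly_cofactor_poly_nonzero[OF assms(1,2)]]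
    unfolding recip_cofactor_def[abs_def] by simp
  then have "?x ^ r * ?x ^ (m j - r) dvd ?x ^ r * (?c * ?T - 1)"
    by (rule mult_dvd_mono[OF dvd_refl])
  moreover have "?x ^ r * ?x ^ (m j - r) = ?x ^ m j"
    using assms(3) by (simp flip: power_add)
  moreover have "?x ^ r * (?c * ?T - 1) = L_poly \<alpha> m s j r - ?x ^ r"
    unfolding L_poly_def by (simp add: algebra_simps)
  ultimately show ?thesis
    by metis
qed

text \<open>
  Expand \<open>x ^ n = ((x - a) + a) ^ n\<close> by the binomial theorem; the terms with \<open>r \<ge> N\<close> are multiples of
  \<open>(x - a) ^ N\<close>.
\<close>

lemma linear_power_dvd_monom_diff_taylor:
  fixes a :: "'a :: comm_ring_1"
  shows "[:- a, 1:] ^ N dvd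
    monom 1 n - (\<Sum>r<N. Polynomial.smult (of_nat (n choose r) * a ^ (n - r)) ([:- a, 1:] ^ r))"
proof -
  let ?t = "\<lambda>r. Polynomial.smult (of_nat (n choose r) * a ^ (n - r)) ([:- a, 1:] ^ r)"
  have vanish: "?t r = 0" if "\<not> r \<le> n" for r
    using that by (simp add: binomial_eq_0)
  have "monom 1 n = ([:- a, 1:] + [:a:]) ^ n"
    by (simp add: monom_altdef)
  also have "\<dots> = (\<Sum>r\<le>n. ?t r)"
    by (subst binomial_ring)
      (simp add: poly_const_pow of_nat_poly mult.assoc mult.commute flip: smult_smult)
  \<comment> \<open>The range is enlarged with zero terms so that it covers \<open>{..<N}\<close> also when \<open>N > n + 1\<close>.\<close>
  also have "\<dots> = (\<Sum>r<N + Suc n. ?t r)"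
    by (rule sum.mono_neutral_left) (use vanish in auto)
  also have "\<dots> = (\<Sum>r<N. ?t r) + (\<Sum>r\<in>{N..<N + Suc n}. ?t r)"
    using sum.atLeastLessThan_concat[of 0 N "N + Suc n" ?t] by (simp add: lessThan_atLeast0)
  finally have "monom 1 n - (\<Sum>r<N. ?t r) = (\<Sum>r\<in>{N..<N + Suc n}. ?t r)"
    by simp
  also have "[:- a, 1:] ^ N dvd \<dots>"
    by (intro dvd_sum dvd_smult le_imp_power_dvd) simp
  finally show ?thesis .
qed

text \<open>
  Modulo the power that belongs to the root with index \<open>l\<close>, only the inner sum for \<open>j = l\<close> survives,
  and it becomes the start of the Taylor expansion of \<open>x ^ n\<close> at that root.
\<close>

lemma factored_poly_dvd_monom_diff_interpolation:
  assumes "inj_on \<alpha> {1..s}"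
  shows "factored_poly \<alpha> m s dvd
    monom 1 n - (\<Sum>j\<in>{1..s}. \<Sum>r<m j.
      Polynomial.smult (of_nat (n choose r) * \<alpha> j ^ (n - r)) (L_poly \<alpha> m s j r))"
proof (rule factored_poly_dvdI[OF assms])
  fix l assume l: "l \<in> {1..s}"
  let ?x = "[:- \<alpha> l, 1:]"
  let ?c = "\<lambda>j r. of_nat (n choose r) * \<alpha> j ^ (n - r)"
  let ?S = "\<lambda>j. \<Sum>r<m j. Polynomial.smult (?c j r) (L_poly \<alpha> m s j r)"
  let ?taylor = "\<Sum>r<m l. Polynomial.smult (?c l r) (?x ^ r)"
  have "?x ^ m l dvd (\<Sum>j\<in>{1..s} - {l}. ?S j)"
    using l by (intro dvd_sum dvd_smult linear_power_dvd_L_poly_other) auto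
  moreover have "?x ^ m l dvd ?S l - ?taylor"
    unfolding sum_subtractf[symmetric] smult_diff_right[symmetric]
    using l by (intro dvd_sum dvd_smult linear_power_dvd_L_poly_own[OF assms]) auto
  moreover have "?x ^ m l dvd monom 1 n - ?taylor"
    by (rule linear_power_dvd_monom_diff_taylor)
  ultimately have "?x ^ m l dvd
      (monom 1 n - ?taylor) - (?S l - ?taylor) - (\<Sum>j\<in>{1..s} - {l}. ?S j)"
    by (intro dvd_diff[OF dvd_diff])
  also have "\<dots> = monom 1 n - (\<Sum>j\<in>{1..s}. ?S j)"
    using sum.remove[of "{1..s}" l ?S] l by (simp add: algebra_simps)
  finally show "?x ^ m l dvd monom 1 n - (\<Sum>j\<in>{1..s}. ?S j)" .
qed

section \<open>The power formula\<close>

lemma binomial_mult_zero_power: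
  "of_nat (n choose j) * (0 :: 'a :: semiring_1) ^ (n - j) = (if n = j then 1 else 0)"
  by (cases n j rule: linorder_cases) (auto simp: power_0_left binomial_eq_0)

theorem theorem3p1:
  fixes A :: "complex mat" and \<alpha> :: "nat \<Rightarrow> complex" and m :: "nat \<Rightarrow> nat"
    and B :: "nat \<Rightarrow> nat \<Rightarrow> complex mat" and k s n :: nat
  assumes "k \<ge> 1" and "A \<in> carrier_mat k k"
    and "s \<ge> 1"
    and "char_poly A = factored_poly \<alpha> m s"
    and "inj_on \<alpha> {1..s}"
    and "\<alpha> 1 = 0"
    and "\<And>j. j \<in> {2..s} \<Longrightarrow> m j \<ge> 1"
    and "\<And>j r. j \<in> {1..s} \<Longrightarrow> r < m j \<Longrightarrow> B j r = poly_mat (L_poly \<alpha> m s j r) A"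
  shows "A ^\<^sub>m n =
    (\<Oplus>\<^bsub>module_mat TYPE(complex) k k\<^esub>j\<in>{..<m 1}. (if n = j then 1 else 0) \<cdot>\<^sub>m B 1 j) +
    (\<Oplus>\<^bsub>module_mat TYPE(complex) k k\<^esub>i\<in>{2..s}.
       (\<Oplus>\<^bsub>module_mat TYPE(complex) k k\<^esub>j\<in>{..<m i}.
          (of_nat (n choose j) * \<alpha> i ^ (n - j)) \<cdot>\<^sub>m B i j))"
proof -
  let ?M = "module_mat TYPE(complex) k k"
  let ?c = "\<lambda>i j. of_nat (n choose j) * \<alpha> i ^ (n - j)"
  note A = assms(2)
  have B: "B i j \<in> carrier_mat k k" if "i \<in> {1..s}" "j < m i" for i j
    using that assms(8) poly_mat_carrier[OF A] by simp
  define S1 where "S1 = (\<Oplus>\<^bsub>?M\<^esub>j\<in>{..<m 1}. (if n = j then 1 else 0) \<cdot>\<^sub>m B 1 j)"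
  define S where "S i = (\<Oplus>\<^bsub>?M\<^esub>j\<in>{..<m i}. ?c i j \<cdot>\<^sub>m B i j)" for i
  define S2 where "S2 = (\<Oplus>\<^bsub>?M\<^esub>i\<in>{2..s}. S i)"
  have S1: "S1 \<in> carrier_mat k k"
    unfolding S1_def using B assms(3) by (intro finsum_module_mat_carrier) auto
  have S: "S i \<in> carrier_mat k k" if "i \<in> {1..s}" for i
    unfolding S_def using B that by (intro finsum_module_mat_carrier) auto
  have S2: "S2 \<in> carrier_mat k k"
    unfolding S2_def using S by (intro finsum_module_mat_carrier) auto
  have "A ^\<^sub>m n = S1 + S2"
  proof (rule eq_matI)
    fix a b assume "a < dim_row (S1 + S2)" "b < dim_col (S1 + S2)"
    then have a: "a < k" and b: "b < k"
      using S1 S2 by auto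
    have "S1 $$ (a, b) = (\<Sum>j<m 1. (if n = j then 1 else 0) * B 1 j $$ (a, b))"
      unfolding S1_def using B assms(3) a b by (intro index_finsum_module_mat_smult) auto
    \<comment> \<open>With \<open>0 ^ 0 = 1\<close>, the Kronecker delta is the general coefficient at the root \<open>0\<close>, so
      the first sum can join the others.\<close>
    then have S1_index: "S1 $$ (a, b) = (\<Sum>j<m 1. ?c 1 j * B 1 j $$ (a, b))"
      unfolding assms(6) binomial_mult_zero_power .
    have S_index: "S i $$ (a, b) = (\<Sum>j<m i. ?c i j * B i j $$ (a, b))" if "i \<in> {1..s}" for i
      unfolding S_def using B that a b by (intro index_finsum_module_mat_smult) auto
    have "S2 $$ (a, b) = (\<Sum>i\<in>{2..s}. S i $$ (a, b))"
      unfolding S2_def using S a b by (intro index_finsum_module_mat) auto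
    also have "\<dots> = (\<Sum>i\<in>{2..s}. \<Sum>j<m i. ?c i j * B i j $$ (a, b))"
      by (intro sum.cong S_index) auto
    finally have S2_index: "S2 $$ (a, b) = (\<Sum>i\<in>{2..s}. \<Sum>j<m i. ?c i j * B i j $$ (a, b))" .
    have "0 = poly_mat (monom 1 n - (\<Sum>i\<in>{1..s}. \<Sum>j<m i.
        Polynomial.smult (?c i j) (L_poly \<alpha> m s i j))) A $$ (a, b)"
      using char_poly_dvd_imp_poly_mat_eq_0[OF A _ a b]
        factored_poly_dvd_monom_diff_interpolation[OF assms(5)]
      by (simp add: assms(4))
    also have "\<dots> = (A ^\<^sub>m n) $$ (a, b) -
        (\<Sum>i\<in>{1..s}. \<Sum>j<m i. ?c i j * poly_mat (L_poly \<alpha> m s i j) A $$ (a, b))"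
      by (simp add: poly_mat_index_diff[OF A a b] poly_mat_index_sum[OF A a b]
          poly_mat_index_smult[OF A a b] poly_mat_index_monom[OF A a b])
    also have "(\<Sum>i\<in>{1..s}. \<Sum>j<m i. ?c i j * poly_mat (L_poly \<alpha> m s i j) A $$ (a, b)) =
        (\<Sum>i\<in>{1..s}. \<Sum>j<m i. ?c i j * B i j $$ (a, b))"
      by (intro sum.cong) (simp_all add: assms(8))
    also have "\<dots> = S1 $$ (a, b) + S2 $$ (a, b)"
      unfolding S1_index S2_index using assms(3)
      by (subst sum.atLeast_Suc_atMost) (simp_all add: numeral_2_eq_2)
    finally show "(A ^\<^sub>m n) $$ (a, b) = (S1 + S2) $$ (a, b)"
      using a b S2 by simp
  qed (use A S1 S2 in auto)
  then show ?thesis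
    unfolding S1_def S2_def S_def .
qed

end
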